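(* Let $\mathcal{H}$ be a complex Hilbert space of finite dimension $d\ge2$, let $\mathcal{A}=\{A_a\}$ be an informationally complete POVM on $\mathcal{H}$, let $\mathcal{O}$ be a Hermitian operator (observable) on $\mathcal{H}$, and let $\overline{\mathrm{Var}[\hat o|\mathcal{P}]}$ be the variance of the single-measurement estimator of the expectation value of $\mathcal{O}$ built from the optimal dual frame $|A'_a\rangle=F_s(\mathcal{A})^{-1}|A_a\rangle/\langle A_a|I\rangle$, averaged over all states unitarily equivalent to a given state of purity $\mathcal{P}$. Then $$\overline{\mathrm{Var}[\hat o|\mathcal{P}]}\ \le\ \frac{V}{d}\left[\frac{1}{s(\mathcal{A})}-\frac{d\,\mathcal{P}-1}{d^2-1}\right],\qquad V=\mathrm{Tr}[\mathcal{O}^2]-\frac{\mathrm{Tr}[\mathcal{O}]^2}{d}.$$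
   Context: $\mathcal{L}(\mathcal{H})$ is the space of linear operators on $\mathcal{H}$ with the Hilbert–Schmidt inner product $\langle A|B\rangle=\mathrm{Tr}[A^\dagger B]$; $|A\rangle$ denotes $A$ regarded as a vector of this Hilbert space. A POVM $\mathcal{A}=\{A_a\}$ on $\mathcal{H}$ is a finite family of nonzero positive semidefinite operators (effects) with $\sum_a A_a=I$; it is informationally complete if its effects span $\mathcal{L}(\mathcal{H})$. The scaled frame operator is $F_s(\mathcal{A})=\sum_a |A_a\rangle\langle A_a|/\langle A_a|I\rangle$, i.e. $F_s(\mathcal{A})(X)=\sum_a\frac{\mathrm{Tr}[A_aX]}{\mathrm{Tr}[A_a]}A_a$; it is invertible when $\mathcal{A}$ is informationally complete. The completeness stability $s(\mathcal{A})$ is the minimum eigenvalue of $F_s(\mathcal{A})$. Estimation: a state is a positive semidefinite operator $\rho$ with $\mathrm{Tr}\,\rho=1$, with purity $\mathcal{P}=\mathrm{Tr}[\rho^2]$. Measuring $\mathcal{A}$ once on $\rho$ gives outcome $a$ with probability $p_a=\mathrm{Tr}[\rho A_a]$, and the estimator takes the value $\hat o(a)=\mathrm{Tr}[\mathcal{O}A'_a]$, an unbiased estimator of $\mathrm{Tr}[\mathcal{O}\rho]$, with variance $\mathrm{Var}[\hat o|\rho]=\sum_a p_a\,\hat o(a)^2-\mathrm{Tr}[\mathcal{O}\rho]^2$. $\overline{\mathrm{Var}[\hat o|\mathcal{P}]}$ is the average of $\mathrm{Var}[\hat o|U\rho U^\dagger]$ over Haar-distributed unitaries $U$ on $\mathcal{H}$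 (it depends on $\rho$ only through $\mathcal{P}$). *)

theory Defs
  imports "HOL-Analysis.Analysis" "HOL-Probability.Probability_Measure"
begin

text \<open>
  A choice of orthonormal basis identifies \<open>H\<close> with \<open>complex ^ 'n\<close> (so \<open>d = CARD('n)\<close>) and
  the linear operators on \<open>H\<close> with the square matrices \<open>complex ^ 'n ^ 'n\<close>.
\<close>

text \<open>
  The library's \<open>*s\<close> multiplies a vector by an element of its component type, which for a matrix
  is a row, and \<open>*\<^sub>R\<close> only provides real scalars.
\<close>

definition mscale :: "complex \<Rightarrow> complex ^ 'n ^ 'm \<Rightarrow> complex ^ 'n ^ 'm"  (infixr "*\<^sub>M" 75)
  where "c *\<^sub>M A = (\<chi> i j. c * A $ i $ j)"

global_interpretation cmat: vector_space "mscale :: complex \<Rightarrow> complex ^ 'n ^ 'm \<Rightarrow> complex ^ 'n ^ 'm"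
  by unfold_locales (simp_all add: mscale_def vec_eq_iff algebra_simps)

definition dagger :: "complex ^ 'n ^ 'm \<Rightarrow> complex ^ 'm ^ 'n"
  where "dagger A = (\<chi> i j. cnj (A $ j $ i))"

definition hermitian :: "complex ^ 'n ^ 'n \<Rightarrow> bool"
  where "hermitian A \<longleftrightarrow> dagger A = A"

definition unitary :: "complex ^ 'n ^ 'n \<Rightarrow> bool"
  where "unitary U \<longleftrightarrow> dagger U ** U = mat 1 \<and> U ** dagger U = mat 1"

text \<open>Hermiticity makes the quadratic form real, so that \<open>Re\<close> discards nothing.\<close>

definition pos_semidef :: "complex ^ 'n ^ 'n \<Rightarrow> bool"
  where "pos_semidef A \<longleftrightarrow>
    hermitian A \<and> (\<forall>x. 0 \<le> Re (\<Sum>i\<in>UNIV. cnj (x $ i) * (A *v x) $ i))"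

definition hs_inner :: "complex ^ 'n ^ 'n \<Rightarrow> complex ^ 'n ^ 'n \<Rightarrow> complex"
  where "hs_inner A B = trace (dagger A ** B)"

definition density_operator :: "complex ^ 'n ^ 'n \<Rightarrow> bool"
  where "density_operator \<rho> \<longleftrightarrow> pos_semidef \<rho> \<and> trace \<rho> = 1"

definition purity :: "complex ^ 'n ^ 'n \<Rightarrow> real"
  where "purity \<rho> = Re (trace (\<rho> ** \<rho>))"

definition povm :: "'a set \<Rightarrow> ('a \<Rightarrow> complex ^ 'n ^ 'n) \<Rightarrow> bool"
  where "povm I A \<longleftrightarrow>
    finite I \<and> (\<forall>a\<in>I. pos_semidef (A a) \<and> A a \<noteq> 0) \<and> (\<Sum>a\<in>I. A a) = mat 1"

definition informationally_complete :: "'a set \<Rightarrow> ('a \<Rightarrow> complex ^ 'n ^ 'n) \<Rightarrow> bool"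
  where "informationally_complete I A \<longleftrightarrow> cmat.span (A ` I) = UNIV"

definition scaled_frame_op ::
    "'a set \<Rightarrow> ('a \<Rightarrow> complex ^ 'n ^ 'n) \<Rightarrow> complex ^ 'n ^ 'n \<Rightarrow> complex ^ 'n ^ 'n"
  where "scaled_frame_op I A X =
    (\<Sum>a\<in>I. (hs_inner (A a) X / hs_inner (A a) (mat 1)) *\<^sub>M A a)"

definition eigenvalue :: "(complex ^ 'n ^ 'n \<Rightarrow> complex ^ 'n ^ 'n) \<Rightarrow> complex \<Rightarrow> bool"
  where "eigenvalue F c \<longleftrightarrow> (\<exists>X. X \<noteq> 0 \<and> F X = c *\<^sub>M X)"

text \<open>
  For a POVM the scaled frame operator is self-adjoint with respect to \<open>hs_inner\<close>, so all its
  eigenvalues are real.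
\<close>

definition completeness_stability :: "'a set \<Rightarrow> ('a \<Rightarrow> complex ^ 'n ^ 'n) \<Rightarrow> real"
  where "completeness_stability I A =
    Min {r. eigenvalue (scaled_frame_op I A) (complex_of_real r)}"

definition dual_frame ::
    "'a set \<Rightarrow> ('a \<Rightarrow> complex ^ 'n ^ 'n) \<Rightarrow> 'a \<Rightarrow> complex ^ 'n ^ 'n"
  where "dual_frame I A a =
    (1 / hs_inner (A a) (mat 1)) *\<^sub>M inv (scaled_frame_op I A) (A a)"

text \<open>
  In the quantities below \<open>Re\<close> only converts the type: the traces are of products of two
  Hermitian matrices (the dual frame of an informationally complete POVM is Hermitian), hence real.
\<close>

definition outcome_prob ::
    "('a \<Rightarrow> complex ^ 'n ^ 'n) \<Rightarrow> complex ^ 'n ^ 'n \<Rightarrow> 'a \<Rightarrow> real"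
  where "outcome_prob A \<rho> a = Re (trace (\<rho> ** A a))"

definition estimator ::
    "'a set \<Rightarrow> ('a \<Rightarrow> complex ^ 'n ^ 'n) \<Rightarrow> complex ^ 'n ^ 'n \<Rightarrow> 'a \<Rightarrow> real"
  where "estimator I A Obs a = Re (trace (Obs ** dual_frame I A a))"

definition estimator_variance ::
    "'a set \<Rightarrow> ('a \<Rightarrow> complex ^ 'n ^ 'n) \<Rightarrow> complex ^ 'n ^ 'n \<Rightarrow> complex ^ 'n ^ 'n \<Rightarrow> real"
  where "estimator_variance I A Obs \<rho> =
    (\<Sum>a\<in>I. outcome_prob A \<rho> a * (estimator I A Obs a)\<^sup>2) - (Re (trace (Obs ** \<rho>)))\<^sup>2"

text \<open>
  The Haar probability measure on the unitary group is the unique left-invariant Borel probability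
  measure; on a compact group it is also right-invariant.
\<close>

definition unitary_haar_measure :: "(complex ^ 'n ^ 'n) measure \<Rightarrow> bool"
  where "unitary_haar_measure \<mu> \<longleftrightarrow>
    prob_space \<mu> \<and>
    sets \<mu> = sets (restrict_space borel {U. unitary U}) \<and>
    (\<forall>W. unitary W \<longrightarrow> distr \<mu> \<mu> (\<lambda>U. W ** U) = \<mu>)"

definition average_variance ::
    "(complex ^ 'n ^ 'n) measure \<Rightarrow> 'a set \<Rightarrow> ('a \<Rightarrow> complex ^ 'n ^ 'n) \<Rightarrow>
      complex ^ 'n ^ 'n \<Rightarrow> complex ^ 'n ^ 'n \<Rightarrow> real"
  where "average_variance \<mu> I A Obs \<rho> =
    (LINT U|\<mu>. estimator_variance I A Obs (U ** \<rho> ** dagger U))"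

end

theory Submission
  imports Defs
begin

text \<open>
  By the second-moment formula for the unitary group, the entries of \<open>X = U \<rho> U\<^sup>\<dagger>\<close> satisfy
  \<open>E[X\<^sub>i\<^sub>j X\<^sub>k\<^sub>l] = \<alpha> \<delta>\<^sub>i\<^sub>j \<delta>\<^sub>k\<^sub>l + \<beta> \<delta>\<^sub>i\<^sub>l \<delta>\<^sub>j\<^sub>k\<close>. Only three kinds of unitaries are needed to see this: diagonal
  phases kill all other entries, permutations make the remaining ones constant, and one reflection
  of a coordinate plane relates \<open>E[X\<^sub>i\<^sub>i\<^sup>2]\<close> to \<open>\<alpha> + \<beta>\<close>. Contracting indices determines \<open>\<alpha>\<close> and
  \<open>\<beta>\<close> from \<open>Tr \<rho> = 1\<close> and the purity, and gives \<open>E[X] = I/d\<close>. The averaged first term of the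
  variance is then at most \<open>\<langle>F\<^sup>-\<^sup>1 O, O\<rangle> / d\<close>, where \<open>F\<close> is the scaled frame operator. As \<open>F I = I\<close>,
  the trace part of \<open>O\<close> splits off, and on the traceless part \<open>F\<^sup>-\<^sup>1\<close> is bounded by
  \<open>1/s\<close>, the lowest eigenvalue \<open>s\<close> of \<open>F\<close> being the minimum of its Rayleigh quotient.
  Self-adjointness is used for the real inner product \<open>Re \<langle>X|Y\<rangle>\<close>, which is the library's inner
  product on matrices.
\<close>

subsection \<open>Self-adjoint maps on Euclidean spaces\<close>

text \<open>The Rayleigh quotient attains its minimum \<open>l\<close> on the compact unit sphere at
  some \<open>v\<close>. Moving \<open>v\<close> along the residual \<open>f v - l v\<close> would
  lower the quotient to first order unless that residual is zero.\<close>

lemma selfadjoint_lowest_eigenvalue: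
  fixes f :: "'v::euclidean_space \<Rightarrow> 'v"
  assumes lin: "linear f" and sa: "\<And>x y. inner x (f y) = inner (f x) y"
  obtains l v where "v \<noteq> 0" "f v = l *\<^sub>R v" "\<And>x. l * inner x x \<le> inner x (f x)"
proof -
  have cont: "continuous_on (sphere 0 1) (\<lambda>x. inner x (f x))"
    using linear_continuous_on[OF lin[unfolded linear_conv_bounded_linear]]
    by (rule continuous_on_inner[OF continuous_on_id])
  have "sphere (0::'v) 1 \<noteq> {}" by simp
  then obtain v where v: "v \<in> sphere 0 1"
    and vmin: "\<And>x. x \<in> sphere 0 1 \<Longrightarrow> inner v (f v) \<le> inner x (f x)"
    using continuous_attains_inf[OF compact_sphere _ cont] by blast
  define l where "l = inner v (f v)"
  have vv: "inner v v = 1" using v by (simp add: dot_square_norm)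
  have bound: "l * inner x x \<le> inner x (f x)" for x
  proof (cases "x = 0")
    case False
    let ?y = "x /\<^sub>R norm x"
    have "l \<le> inner ?y (f ?y)" using vmin[of ?y] False by (simp add: l_def)
    also have "\<dots> = inner x (f x) / inner x x"
      by (simp add: linear_scale[OF lin] dot_square_norm power2_eq_square field_simps)
    finally show ?thesis using False by (simp add: field_simps)
  qed (use linear_0[OF lin] in simp)
  define z where "z = f v - l *\<^sub>R v"
  have lin_coeff: "inner z (f v) - l * inner z v = inner z z"
    by (simp add: z_def inner_diff_right)
  \<comment> \<open>There is no constant term because \<open>v\<close> attains the bound, and the
    linear coefficient is \<open>2 * inner z z\<close>; nonnegativity for small negative
    \<open>t\<close> therefore forces \<open>z = 0\<close>.\<close>
  have quad: "0 \<le> 2 * t * inner z z + t\<^sup>2 * (inner z (f z) - l * inner z z)" for t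
  proof -
    have "0 \<le> inner (v + t *\<^sub>R z) (f (v + t *\<^sub>R z)) - l * inner (v + t *\<^sub>R z) (v + t *\<^sub>R z)"
      using bound[of "v + t *\<^sub>R z"] by linarith
    also have "\<dots> = 2 * t * (inner z (f v) - l * inner z v) + t\<^sup>2 * (inner z (f z) - l * inner z z)"
    proof -
      have "inner v (f z) = inner z (f v)" using sa[of v z] by (simp add: inner_commute)
      moreover have "inner v (f v) = l" by (simp add: l_def)
      moreover have "inner v z = inner z v" by (rule inner_commute)
      ultimately show ?thesis
        using vv by (simp add: linear_add[OF lin] linear_scale[OF lin] inner_add_left inner_add_right)
          (simp add: algebra_simps power2_eq_square)
    qed
    finally show ?thesis by (simp only: lin_coeff)
  qed
  have "inner z z = 0"
  proof (rule ccontr)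
    assume "inner z z \<noteq> 0"
    then have p: "inner z z > 0" using inner_ge_zero[of z] by linarith
    \<comment> \<open>\<open>c\<close> is positive and dominates the quadratic coefficient, so at
      this \<open>t\<close> the quadratic term offsets at most half of the negative linear
      term.\<close>
    define c where "c = \<bar>inner z (f z) - l * inner z z\<bar> + 1"
    define t where "t = - inner z z / c"
    have c: "c > 0" "inner z (f z) - l * inner z z \<le> c" by (simp_all add: c_def)
    have "t\<^sup>2 * (inner z (f z) - l * inner z z) \<le> t\<^sup>2 * c" using c by (simp add: mult_left_mono)
    also have "\<dots> = (inner z z)\<^sup>2 / c" using c by (simp add: t_def power2_eq_square)
    finally have "0 \<le> 2 * t * inner z z + (inner z z)\<^sup>2 / c" using quad[of t] by linarith
    also have "\<dots> = - (inner z z)\<^sup>2 / c" by (simp add: t_def power2_eq_square field_simps)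
    also have "\<dots> < 0" using p c by simp
    finally show False by simp
  qed
  then have "f v = l *\<^sub>R v" by (simp add: z_def)
  moreover have "v \<noteq> 0" using vv by auto
  ultimately show ?thesis using bound that by blast
qed

text \<open>Eigenvectors for distinct eigenvalues are orthogonal, hence independent. Finiteness
  gives the \<open>Min\<close> in \<open>completeness_stability\<close> its meaning.\<close>

lemma finite_selfadjoint_eigenvalues:
  fixes f :: "'v::euclidean_space \<Rightarrow> 'v"
  assumes sa: "\<And>x y. inner x (f y) = inner (f x) y"
  shows "finite {r. \<exists>x. x \<noteq> 0 \<and> f x = r *\<^sub>R x}" (is "finite ?R")
proof -
  have "\<forall>r\<in>?R. \<exists>x. x \<noteq> 0 \<and> f x = r *\<^sub>R x" by blast
  then obtain g where g: "\<And>r. r \<in> ?R \<Longrightarrow> g r \<noteq> 0 \<and> f (g r) = r *\<^sub>R g r"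
    by (rule bchoice[THEN exE]) blast
  have orth: "inner (g r) (g s) = 0" if "r \<in> ?R" "s \<in> ?R" "r \<noteq> s" for r s
    using sa[of "g r" "g s"] g[OF that(1)] g[OF that(2)] that(3) by auto
  have inj: "inj_on g ?R"
  proof (rule inj_onI, rule ccontr)
    fix r s assume "r \<in> ?R" "s \<in> ?R" "g r = g s" "r \<noteq> s"
    then show False using orth[of r s] g[of r] by simp
  qed
  have "pairwise orthogonal (g ` ?R)"
    using orth unfolding pairwise_def orthogonal_def by blast
  moreover have "0 \<notin> g ` ?R" using g by force
  ultimately have "finite (g ` ?R)"
    using pairwise_orthogonal_independent finiteI_independent by blast
  then show ?thesis using finite_imageD[OF _ inj] by blast
qed

text \<open>With \<open>y = f\<^sup>-\<^sup>1 x\<close>, Cauchy--Schwarz and the lower bound \<open>l\<close> give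
  \<open>\<langle>x, y\<rangle>\<^sup>2 \<le> |x|\<^sup>2 |y|\<^sup>2 \<le> |x|\<^sup>2 \<langle>x, y\<rangle> / l\<close>.\<close>

lemma inner_preimage_le:
  fixes f :: "'v::real_inner \<Rightarrow> 'v"
  assumes "l > 0" and low: "l * inner y y \<le> inner y (f y)"
  shows "inner y (f y) \<le> inner (f y) (f y) / l"
proof (cases "inner y (f y) \<le> 0")
  case True
  then show ?thesis using assms(1) by (smt (verit) divide_nonneg_pos inner_ge_zero)
next
  case False
  have "(inner y (f y))\<^sup>2 * l \<le> (inner y y * inner (f y) (f y)) * l"
    using Cauchy_Schwarz_ineq assms(1) by (simp add: mult_right_mono)
  also have "\<dots> = (l * inner y y) * inner (f y) (f y)" by simp
  also have "\<dots> \<le> inner y (f y) * inner (f y) (f y)"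
    using low by (simp add: mult_right_mono)
  finally show ?thesis using False assms(1) by (simp add: power2_eq_square field_simps)
qed

subsection \<open>The scaled frame operator\<close>

lemma hs_inner_eq_sum: "hs_inner A B = (\<Sum>i\<in>UNIV. \<Sum>j\<in>UNIV. cnj (A $ i $ j) * B $ i $ j)"
  unfolding hs_inner_def trace_def dagger_def matrix_matrix_mult_def
  by (simp, rule sum.swap)

text \<open>The bridge that lets results on real Euclidean spaces apply to complex
  operators.\<close>

lemma Re_hs_inner: "Re (hs_inner A B) = inner A B"
  by (simp add: hs_inner_eq_sum inner_vec_def inner_complex_def)

lemma hs_inner_add_right: "hs_inner A (X + Y) = hs_inner A X + hs_inner A Y"
  by (simp add: hs_inner_eq_sum algebra_simps sum.distrib)

lemma hs_inner_mscale_right: "hs_inner A (c *\<^sub>M X) = c * hs_inner A X"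
  by (simp add: hs_inner_eq_sum mscale_def sum_distrib_left algebra_simps)

lemma cnj_hs_inner: "cnj (hs_inner A B) = hs_inner B A"
  by (simp add: hs_inner_eq_sum mult.commute)

lemma of_real_mscale: "complex_of_real r *\<^sub>M X = r *\<^sub>R X"
  by (simp add: mscale_def vec_eq_iff complex_eq_iff)

lemma hs_inner_mat_1: "hermitian A \<Longrightarrow> hs_inner A (mat 1) = trace A"
  by (simp add: hs_inner_def hermitian_def)

lemma hermitian_entry: "hermitian A \<Longrightarrow> cnj (A $ i $ j) = A $ j $ i"
  by (metis (mono_tags, lifting) dagger_def hermitian_def vec_lambda_beta)

lemma trace_hermitian_real:
  assumes "hermitian A"
  shows "trace A = complex_of_real (Re (trace A))"
proof -
  have "cnj (trace A) = trace A" by (simp add: trace_def hermitian_entry[OF assms])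
  then show ?thesis by (simp add: Reals_cnj_iff[symmetric])
qed

text \<open>Basis vectors show that the diagonal is nonnegative, so a vanishing trace makes it zero;
  vectors supported on two coordinates then force the off-diagonal entries to vanish. This keeps the
  denominators of the frame operator positive.\<close>

lemma pos_semidef_trace_pos:
  fixes A :: "complex ^ 'n ^ 'n"
  assumes psd: "pos_semidef A" and "A \<noteq> 0"
  shows "Re (trace A) > 0"
proof -
  have herm: "hermitian A" and nonneg: "\<And>x. 0 \<le> Re (\<Sum>i\<in>UNIV. cnj (x $ i) * (A *v x) $ i)"
    using psd by (auto simp: pos_semidef_def)
  have form: "(\<Sum>i\<in>UNIV. cnj (x $ i) * (A *v x) $ i)
      = (\<Sum>i\<in>UNIV. \<Sum>j\<in>UNIV. cnj (x $ i) * A $ i $ j * x $ j)" for x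
    by (simp add: matrix_vector_mult_def sum_distrib_left mult.assoc)
  have supp: "(\<Sum>i\<in>UNIV. \<Sum>j\<in>UNIV. cnj (x $ i) * A $ i $ j * x $ j)
      = (\<Sum>i\<in>S. \<Sum>j\<in>S. cnj (x $ i) * A $ i $ j * x $ j)"
    if "\<And>i. i \<notin> S \<Longrightarrow> x $ i = 0" for x S
  proof -
    have "(\<Sum>i\<in>UNIV. \<Sum>j\<in>UNIV. cnj (x $ i) * A $ i $ j * x $ j)
      = (\<Sum>i\<in>S. \<Sum>j\<in>UNIV. cnj (x $ i) * A $ i $ j * x $ j)"
      using that by (intro sum.mono_neutral_right) auto
    also have "\<dots> = (\<Sum>i\<in>S. \<Sum>j\<in>S. cnj (x $ i) * A $ i $ j * x $ j)"
      using that by (intro sum.cong refl sum.mono_neutral_right) auto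
    finally show ?thesis .
  qed
  have diag: "0 \<le> Re (A $ p $ p)" for p
    using nonneg[of "axis p 1"] unfolding form
    by (subst (asm) supp[of "{p}"]) (auto simp: axis_def)
  show ?thesis
  proof (rule ccontr)
    assume "\<not> ?thesis"
    then have "(\<Sum>p\<in>UNIV. Re (A $ p $ p)) = 0"
      using diag by (simp add: trace_def sum_nonneg order_antisym)
    then have d0: "Re (A $ p $ p) = 0" for p
      using diag by (simp add: sum_nonneg_eq_0_iff)
    have "A $ p $ q = 0" for p q
    proof (cases "p = q")
      case True
      then show ?thesis using d0[of p] hermitian_entry[OF herm, of p p]
        by (auto simp: complex_eq_iff)
    next
      case False
      \<comment> \<open>With a zero diagonal only the two conjugate cross terms survive, and the
        entry \<open>- A $ p $ q\<close> makes each of them minus its squared modulus.\<close>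
      define x :: "complex ^ 'n" where "x = (\<chi> i. if i = p then - A $ p $ q else if i = q then 1 else 0)"
      have "(\<Sum>i\<in>UNIV. \<Sum>j\<in>UNIV. cnj (x $ i) * A $ i $ j * x $ j)
        = (\<Sum>i\<in>{p,q}. \<Sum>j\<in>{p,q}. cnj (x $ i) * A $ i $ j * x $ j)"
        by (rule supp) (auto simp: x_def)
      also have "Re \<dots> = - 2 * (cmod (A $ p $ q))\<^sup>2"
      proof -
        have "A $ q $ p = cnj (A $ p $ q)" using hermitian_entry[OF herm, of p q] by simp
        moreover have "A $ r $ r = 0" for r
          using d0[of r] hermitian_entry[OF herm, of r r] by (auto simp: complex_eq_iff)
        ultimately show ?thesis
          using False by (simp add: x_def cmod_power2) (simp add: power2_eq_square)
      qed
      finally show ?thesis using nonneg[of x] unfolding form by simp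
    qed
    then show False using \<open>A \<noteq> 0\<close> by (simp add: vec_eq_iff)
  qed
qed

lemma hs_inner_sum_right: "hs_inner A (\<Sum>a\<in>I. f a) = (\<Sum>a\<in>I. hs_inner A (f a))"
proof (induction I rule: infinite_finite_induct)
qed (simp_all add: hs_inner_add_right, simp_all add: hs_inner_eq_sum)

lemma povm_hs_inner_mat_1:
  assumes "povm I A" "a \<in> I"
  shows "hs_inner (A a) (mat 1) = complex_of_real (Re (trace (A a)))" "Re (trace (A a)) > 0"
proof -
  have psd: "pos_semidef (A a)" "A a \<noteq> 0" using assms by (auto simp: povm_def)
  then have "hermitian (A a)" by (simp add: pos_semidef_def)
  then show "hs_inner (A a) (mat 1) = complex_of_real (Re (trace (A a)))"
    by (simp only: hs_inner_mat_1 trace_hermitian_real[symmetric])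
  show "Re (trace (A a)) > 0" using psd by (rule pos_semidef_trace_pos)
qed

lemma linear_scaled_frame_op: "linear (scaled_frame_op I A)"
proof (rule linearI)
  show "scaled_frame_op I A (X + Y) = scaled_frame_op I A X + scaled_frame_op I A Y" for X Y
    by (simp add: scaled_frame_op_def hs_inner_add_right add_divide_distrib
        cmat.scale_left_distrib sum.distrib)
  show "scaled_frame_op I A (r *\<^sub>R X) = r *\<^sub>R scaled_frame_op I A X" for r X
    by (simp add: scaled_frame_op_def hs_inner_mscale_right cmat.scale_sum_right
        flip: of_real_mscale)
qed

lemma inner_scaled_frame_op:
  assumes "povm I A"
  shows "inner X (scaled_frame_op I A Y) =
    (\<Sum>a\<in>I. Re (cnj (hs_inner (A a) X) * hs_inner (A a) Y) / Re (trace (A a)))"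
  unfolding Re_hs_inner[symmetric] scaled_frame_op_def hs_inner_sum_right Re_sum
  by (intro sum.cong refl)
    (simp add: hs_inner_mscale_right povm_hs_inner_mat_1[OF assms] cnj_hs_inner mult.commute)

lemma scaled_frame_op_selfadjoint:
  assumes "povm I A"
  shows "inner X (scaled_frame_op I A Y) = inner (scaled_frame_op I A X) Y"
  unfolding inner_commute[of "scaled_frame_op I A X"] inner_scaled_frame_op[OF assms]
  by (intro sum.cong refl) (simp add: algebra_simps)

lemma inner_scaled_frame_op_self:
  assumes "povm I A"
  shows "inner X (scaled_frame_op I A X) =
    (\<Sum>a\<in>I. (cmod (hs_inner (A a) X))\<^sup>2 / Re (trace (A a)))"
  unfolding inner_scaled_frame_op[OF assms]
  by (intro sum.cong refl) (simp add: cmod_power2, simp add: power2_eq_square)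

text \<open>The quadratic form is a positively weighted sum of squared overlaps with the effects. If
  it vanished, \<open>X\<close> would be orthogonal to their span, hence to itself.\<close>

lemma scaled_frame_op_pos:
  assumes povm: "povm I A" and ic: "informationally_complete I A" and "X \<noteq> 0"
  shows "inner X (scaled_frame_op I A X) > 0"
proof -
  have nonneg: "0 \<le> (cmod (hs_inner (A a) X))\<^sup>2 / Re (trace (A a))" if "a \<in> I" for a
    using povm_hs_inner_mat_1(2)[OF povm that] by simp
  have "inner X (scaled_frame_op I A X) \<noteq> 0"
  proof
    assume "inner X (scaled_frame_op I A X) = 0"
    then have "\<forall>a\<in>I. (cmod (hs_inner (A a) X))\<^sup>2 / Re (trace (A a)) = 0"
      using povm nonneg unfolding inner_scaled_frame_op_self[OF povm]
      by (subst (asm) sum_nonneg_eq_0_iff) (auto simp: povm_def)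
    then have "hs_inner (A a) X = 0" if "a \<in> I" for a
      using povm_hs_inner_mat_1(2)[OF povm that] that by auto
    then have "A ` I \<subseteq> {Y. hs_inner X Y = 0}"
      by (auto simp: cnj_hs_inner[symmetric, of X])
    \<comment> \<open>The span is complex, so the complex overlap must be used here and not just its
      real part.\<close>
    moreover have "cmat.subspace {Y. hs_inner X Y = 0}"
      unfolding cmat.subspace_def
      by (simp add: hs_inner_add_right hs_inner_mscale_right) (simp add: hs_inner_eq_sum)
    ultimately have "X \<in> {Y. hs_inner X Y = 0}"
      using cmat.span_minimal[of "A ` I" "{Y. hs_inner X Y = 0}"] ic
      unfolding informationally_complete_def by auto
    then have "inner X X = 0" using Re_hs_inner[of X X] by simp
    with \<open>X \<noteq> 0\<close> show False by simp
  qed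
  moreover have "inner X (scaled_frame_op I A X) \<ge> 0"
    unfolding inner_scaled_frame_op_self[OF povm] by (intro sum_nonneg nonneg)
  ultimately show ?thesis by linarith
qed

text \<open>Positivity gives injectivity and finite dimension gives surjectivity, so
  \<open>inv\<close> in \<open>dual_frame\<close> is a genuine inverse.\<close>

lemma bij_scaled_frame_op:
  assumes "povm I A" "informationally_complete I A"
  shows "bij (scaled_frame_op I A)"
proof -
  have "inj (scaled_frame_op I A)"
    using scaled_frame_op_pos[OF assms]
    by (force simp: linear_injective_0[OF linear_scaled_frame_op])
  then show ?thesis
    using linear_injective_imp_surjective[OF linear_scaled_frame_op] by (simp add: bij_def)
qed

lemma scaled_frame_op_mat_1:
  assumes "povm I A"
  shows "scaled_frame_op I A (mat 1) = mat 1"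
proof -
  have "scaled_frame_op I A (mat 1) = (\<Sum>a\<in>I. A a)"
    unfolding scaled_frame_op_def using povm_hs_inner_mat_1[OF assms]
    by (intro sum.cong refl) (simp add: less_imp_neq[symmetric])
  then show ?thesis using assms by (simp add: povm_def)
qed

text \<open>The minimum of the Rayleigh quotient is itself an eigenvalue and bounds all others from
  below, so it is the \<open>Min\<close> of the definition. Positivity is read off at its
  eigenvector.\<close>

lemma completeness_stability_bound:
  assumes "povm I A" "informationally_complete I A"
  shows "completeness_stability I A > 0"
    "completeness_stability I A * inner X X \<le> inner X (scaled_frame_op I A X)"
proof -
  let ?F = "scaled_frame_op I A"
  obtain l v where v: "v \<noteq> 0" "?F v = l *\<^sub>R v" and low: "\<And>x. l * inner x x \<le> inner x (?F x)"
    by (rule selfadjoint_lowest_eigenvalue[OF linear_scaled_frame_op scaled_frame_op_selfadjoint[OF assms(1)]])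
      (rule that; assumption)
  define R where "R = {r. \<exists>x. x \<noteq> 0 \<and> ?F x = r *\<^sub>R x}"
  have S: "{r. eigenvalue ?F (complex_of_real r)} = R"
    by (simp add: eigenvalue_def of_real_mscale R_def)
  have fin: "finite R"
    unfolding R_def by (rule finite_selfadjoint_eigenvalues[OF scaled_frame_op_selfadjoint[OF assms(1)]])
  have mem: "l \<in> R" using v by (auto simp: R_def)
  have le: "l \<le> r" if r: "r \<in> R" for r
  proof -
    obtain x where x: "x \<noteq> 0" "?F x = r *\<^sub>R x" using r by (auto simp: R_def)
    have "l * inner x x \<le> r * inner x x" using low[of x] x(2) by simp
    then show ?thesis using x(1) by (simp add: mult_le_cancel_right)
  qed
  have "Min R = l" by (rule Min_eqI[OF fin le mem])
  then have l: "completeness_stability I A = l" by (simp add: completeness_stability_def S)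
  show "completeness_stability I A * inner X X \<le> inner X (?F X)" using low l by simp
  have "0 < l * inner v v" using scaled_frame_op_pos[OF assms v(1)] v(2) by simp
  then show "completeness_stability I A > 0"
    using l inner_ge_zero[of v] by (simp add: zero_less_mult_iff)
qed

text \<open>Put \<open>Y = inv F Obs\<close>. Self-adjointness moves the inverse from the effect to
  \<open>Obs\<close>, so the estimator is the real overlap of \<open>Y\<close> with
  \<open>A a\<close> divided by the trace of \<open>A a\<close>. Bounding real parts by moduli gives
  the quadratic form of \<open>F\<close> at \<open>Y\<close>; settling for an inequality spares a
  proof that \<open>Y\<close> is Hermitian.\<close>

lemma sum_estimator_sq_le:
  assumes povm: "povm I A" and ic: "informationally_complete I A" and herm: "hermitian Obs"
  shows "(\<Sum>a\<in>I. Re (trace (A a)) * (estimator I A Obs a)\<^sup>2)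
    \<le> inner (inv (scaled_frame_op I A) Obs) Obs"
proof -
  let ?F = "scaled_frame_op I A"
  define Y where "Y = inv ?F Obs"
  have FY: "?F Y = Obs"
    using bij_scaled_frame_op[OF povm ic] by (simp add: Y_def bij_is_surj surj_f_inv_f)
  have est: "estimator I A Obs a = inner Y (A a) / Re (trace (A a))" if "a \<in> I" for a
  proof -
    have "estimator I A Obs a = inner Obs (dual_frame I A a)"
      using herm by (simp add: estimator_def hermitian_def hs_inner_def flip: Re_hs_inner)
    also have "dual_frame I A a = (1 / Re (trace (A a))) *\<^sub>R inv ?F (A a)"
      by (simp add: dual_frame_def povm_hs_inner_mat_1[OF povm that] flip: of_real_mscale)
    also have "inner Obs \<dots> = inner (?F Y) (inv ?F (A a)) / Re (trace (A a))"
      by (simp add: FY)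
    also have "inner (?F Y) (inv ?F (A a)) = inner Y (?F (inv ?F (A a)))"
      by (simp add: scaled_frame_op_selfadjoint[OF povm])
    also have "?F (inv ?F (A a)) = A a"
      using bij_scaled_frame_op[OF povm ic] by (simp add: bij_is_surj surj_f_inv_f)
    finally show ?thesis .
  qed
  have "(\<Sum>a\<in>I. Re (trace (A a)) * (estimator I A Obs a)\<^sup>2)
      \<le> (\<Sum>a\<in>I. (cmod (hs_inner (A a) Y))\<^sup>2 / Re (trace (A a)))"
  proof (rule sum_mono)
    fix a assume a: "a \<in> I"
    note t = povm_hs_inner_mat_1(2)[OF povm a]
    have "(inner Y (A a))\<^sup>2 \<le> (cmod (hs_inner (A a) Y))\<^sup>2"
      using abs_Re_le_cmod[of "hs_inner (A a) Y"]
      by (simp add: abs_le_square_iff[symmetric] Re_hs_inner inner_commute[of Y])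
    then have "(inner Y (A a))\<^sup>2 / Re (trace (A a)) \<le> (cmod (hs_inner (A a) Y))\<^sup>2 / Re (trace (A a))"
      using t by (simp add: divide_right_mono)
    then show "Re (trace (A a)) * (estimator I A Obs a)\<^sup>2 \<le> (cmod (hs_inner (A a) Y))\<^sup>2 / Re (trace (A a))"
      using t by (simp add: est[OF a] power2_eq_square)
  qed
  also have "\<dots> = inner Y Obs" by (simp add: FY flip: inner_scaled_frame_op_self[OF povm])
  finally show ?thesis by (simp add: Y_def)
qed

lemma inner_mat_1: "inner X (mat 1) = Re (trace X)"
proof -
  have "dagger (mat 1 :: complex ^ 'a ^ 'a) = mat 1"
    by (simp add: dagger_def mat_def vec_eq_iff)
  then have "inner (mat 1) X = Re (trace X)"
    by (simp add: hs_inner_def flip: Re_hs_inner)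
  then show ?thesis by (simp add: inner_commute)
qed

text \<open>The identity is a fixed point of the frame operator, so only the traceless part of
  \<open>Obs\<close> feels the spectral bound.\<close>

lemma inner_inv_scaled_frame_op_le:
  fixes Obs :: "complex ^ 'n ^ 'n"
  assumes povm: "povm I A" and ic: "informationally_complete I A" and herm: "hermitian Obs"
    and d: "d = real CARD('n)"
    and V: "V = Re (trace (Obs ** Obs)) - (Re (trace Obs))\<^sup>2 / d"
  shows "inner (inv (scaled_frame_op I A) Obs) Obs
    \<le> V / completeness_stability I A + (Re (trace Obs))\<^sup>2 / d"
proof -
  let ?F = "scaled_frame_op I A"
  have d0: "d > 0" by (simp add: d)
  define c where "c = Re (trace Obs) / d"
  define O0 where "O0 = Obs - c *\<^sub>R mat 1"
  define Y where "Y = inv ?F O0"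
  have FY: "?F Y = O0"
    using bij_scaled_frame_op[OF povm ic] by (simp add: Y_def bij_is_surj surj_f_inv_f)
  have one: "inner (mat 1 :: complex ^ 'n ^ 'n) (mat 1) = d"
    unfolding inner_mat_1 by (simp add: trace_def mat_def d)
  have F1: "?F (mat 1) = mat 1" by (rule scaled_frame_op_mat_1[OF povm])
  have "?F (Y + c *\<^sub>R mat 1) = Obs"
    by (simp add: linear_add[OF linear_scaled_frame_op] linear_scale[OF linear_scaled_frame_op] FY F1 O0_def)
  then have inv: "inv ?F Obs = Y + c *\<^sub>R mat 1"
    using bij_scaled_frame_op[OF povm ic] by (metis bij_inv_eq_iff)
  have traceless: "inner O0 (mat 1) = 0"
    using d0 by (simp add: O0_def inner_diff_left one inner_mat_1[of Obs] c_def)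
  \<comment> \<open>As \<open>F\<close> is self-adjoint and fixes the identity, its inverse
    preserves tracelessness; the cross terms below therefore vanish.\<close>
  have Y1: "inner Y (mat 1) = 0"
    using scaled_frame_op_selfadjoint[OF povm, of Y "mat 1"] traceless by (simp add: FY F1)
  have ObsObs: "inner Obs Obs = Re (trace (Obs ** Obs))"
    using herm by (simp add: hs_inner_def hermitian_def flip: Re_hs_inner)
  have Obs: "Obs = O0 + c *\<^sub>R mat 1" by (simp add: O0_def)
  have "inner (inv ?F Obs) Obs = inner (Y + c *\<^sub>R mat 1) (O0 + c *\<^sub>R mat 1)"
    using inv Obs by simp
  also have "\<dots> = inner Y O0 + c\<^sup>2 * d"
    using traceless Y1 one inner_commute[of O0 "mat 1"]
    by (simp add: inner_add_left inner_add_right power2_eq_square)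
  also have "c\<^sup>2 * d = (Re (trace Obs))\<^sup>2 / d"
    using d0 by (simp add: c_def power2_eq_square)
  also have "inner Y O0 \<le> inner O0 O0 / completeness_stability I A"
    using inner_preimage_le[where f = ?F, OF completeness_stability_bound[OF povm ic], of Y] by (simp add: FY)
  also have "inner O0 O0 = V"
  proof -
    have "inner O0 O0 = inner O0 Obs" using traceless by (simp add: O0_def inner_diff_right)
    also have "\<dots> = inner Obs Obs - c * inner (mat 1) Obs" by (simp add: O0_def inner_diff_left)
    also have "inner (mat 1) Obs = Re (trace Obs)" by (simp add: inner_commute[of "mat 1"] inner_mat_1)
    finally show ?thesis by (simp add: ObsObs V c_def power2_eq_square)
  qed
  finally show ?thesis by simp
qed

subsection \<open>Moments of the Haar measure\<close>

lemma continuous_on_matrix_mult [continuous_intros]: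
  fixes f g :: "'t::topological_space \<Rightarrow> complex ^ 'n ^ 'n"
  assumes "continuous_on S f" "continuous_on S g"
  shows "continuous_on S (\<lambda>x. f x ** g x)"
  unfolding matrix_matrix_mult_def by (intro continuous_intros assms)

lemma continuous_on_dagger [continuous_intros]:
  fixes f :: "'t::topological_space \<Rightarrow> complex ^ 'n ^ 'n"
  assumes "continuous_on S f"
  shows "continuous_on S (\<lambda>x. dagger (f x))"
  unfolding dagger_def by (intro continuous_intros assms)

section \<open>Conjugation by unitaries\<close>

lemma dagger_mult: "dagger (A ** B) = dagger B ** dagger A"
  by (simp add: dagger_def matrix_matrix_mult_def vec_eq_iff mult.commute)

lemma dagger_dagger: "dagger (dagger A) = A"
  by (simp add: dagger_def vec_eq_iff)

lemma unitary_mult: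
  fixes U W :: "complex ^ 'n ^ 'n"
  assumes "unitary W" "unitary U" shows "unitary (W ** U)"
proof -
  have "dagger U ** dagger W ** (W ** U) = dagger U ** (dagger W ** W) ** U"
    "W ** U ** (dagger U ** dagger W) = W ** (U ** dagger U) ** dagger W"
    by (simp_all only: matrix_mul_assoc)
  then show ?thesis using assms by (simp add: unitary_def dagger_mult)
qed

lemma norm_unitary:
  fixes U :: "complex ^ 'n ^ 'n"
  assumes "unitary U" shows "norm U = sqrt (real CARD('n))"
proof -
  have "inner U U = real CARD('n)"
    using assms by (simp add: hs_inner_def unitary_def trace_def mat_def flip: Re_hs_inner)
  then show ?thesis by (simp add: norm_eq_sqrt_inner)
qed

abbreviation conjugate :: "complex ^ 'n ^ 'n \<Rightarrow> complex ^ 'n ^ 'n \<Rightarrow> complex ^ 'n ^ 'n"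
  where "conjugate U \<rho> \<equiv> U ** \<rho> ** dagger U"

lemma conjugate_mult: "conjugate (W ** U) \<rho> = conjugate W (conjugate U \<rho>)"
  by (simp only: dagger_mult matrix_mul_assoc)

lemma trace_conjugate: "unitary U \<Longrightarrow> trace (conjugate U \<rho>) = trace \<rho>"
  by (subst trace_mul_sym) (simp add: unitary_def matrix_mul_assoc)

lemma conjugate_sq:
  assumes "unitary U"
  shows "conjugate U \<rho> ** conjugate U \<rho> = conjugate U (\<rho> ** \<rho>)"
proof -
  have "conjugate U \<rho> ** conjugate U \<rho> = U ** \<rho> ** (dagger U ** U) ** \<rho> ** dagger U"
    by (simp only: matrix_mul_assoc)
  also have "dagger U ** U = mat 1" using assms by (simp add: unitary_def)
  finally show ?thesis by (simp add: matrix_mul_assoc)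
qed

lemma hermitian_conjugate: "hermitian \<rho> \<Longrightarrow> hermitian (conjugate U \<rho>)"
  by (simp add: hermitian_def dagger_mult dagger_dagger matrix_mul_assoc)

lemma conjugate_entry:
  "conjugate W X $ i $ j = (\<Sum>k\<in>UNIV. \<Sum>l\<in>UNIV. W $ i $ k * X $ k $ l * cnj (W $ j $ l))"
  by (simp add: matrix_matrix_mult_def dagger_def sum_distrib_right) (rule sum.swap)

lemma trace_mult_eq_sum: "trace (A ** B) = (\<Sum>i\<in>UNIV. \<Sum>j\<in>UNIV. A $ i $ j * B $ j $ i)"
  by (simp add: trace_def matrix_matrix_mult_def)

lemma trace_mult_hermitian_real:
  assumes "hermitian A" "hermitian B"
  shows "trace (A ** B) = complex_of_real (Re (trace (A ** B)))"
proof -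
  have "cnj (trace (A ** B)) = trace (A ** B)"
    unfolding trace_mult_eq_sum
    by (simp add: hermitian_entry[OF assms(1)] hermitian_entry[OF assms(2)]) (rule sum.swap)
  then show ?thesis by (simp add: Reals_cnj_iff[symmetric])
qed

lemma sum_delta_mult:
  fixes f :: "'i::finite \<Rightarrow> complex"
  shows "(\<Sum>k\<in>UNIV. (if k = i then a else 0) * f k) = a * f i"
    "(\<Sum>k\<in>UNIV. f k * (if k = i then a else 0)) = f i * a"
proof -
  have "(if k = i then a else 0) * f k = (if k = i then a * f k else 0)"
    "f k * (if k = i then a else 0) = (if k = i then f k * a else 0)" for k by simp_all
  then show "(\<Sum>k\<in>UNIV. (if k = i then a else 0) * f k) = a * f i"
    "(\<Sum>k\<in>UNIV. f k * (if k = i then a else 0)) = f i * a" by simp_all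
qed

section \<open>Diagonal phases, permutations and a reflection\<close>

definition phase_matrix :: "'n \<Rightarrow> complex ^ 'n ^ 'n"
  where "phase_matrix m = (\<chi> i j. if j = i then (if i = m then \<i> else 1) else 0)"

lemma unitary_phase_matrix: "unitary (phase_matrix m)"
proof -
  have "(phase_matrix m ** dagger (phase_matrix m)) $ i $ j = mat 1 $ i $ j" for i j :: 'a
    by (simp add: matrix_matrix_mult_def dagger_def phase_matrix_def if_distrib[of cnj] sum_delta_mult)
      (simp add: mat_def)
  then have right: "phase_matrix m ** dagger (phase_matrix m) = mat 1" by (simp add: vec_eq_iff)
  then have "dagger (phase_matrix m) ** phase_matrix m = mat 1"
    by (simp add: matrix_left_right_inverse)
  with right show ?thesis by (simp add: unitary_def)
qed

lemma conjugate_phase_matrix: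
  "conjugate (phase_matrix m) X $ i $ j
    = (if i = m then \<i> else 1) * (if j = m then -\<i> else 1) * X $ i $ j"
proof -
  have "conjugate (phase_matrix m) X $ i $ j = (\<Sum>k\<in>UNIV. (if k = i then if i = m then \<i> else 1 else 0) *
    (\<Sum>l\<in>UNIV. X $ k $ l * (if l = j then if j = m then -\<i> else 1 else 0)))"
    unfolding conjugate_entry sum_distrib_left
    by (intro sum.cong refl) (simp add: phase_matrix_def)
  then show ?thesis by (simp add: sum_delta_mult)
qed

definition perm_matrix :: "('n \<Rightarrow> 'n) \<Rightarrow> complex ^ 'n ^ 'n"
  where "perm_matrix \<pi> = (\<chi> i j. if j = \<pi> i then 1 else 0)"

lemma unitary_perm_matrix:
  fixes \<pi> :: "'n::finite \<Rightarrow> 'n"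
  assumes "bij \<pi>" shows "unitary (perm_matrix \<pi>)"
proof -
  have "(perm_matrix \<pi> ** dagger (perm_matrix \<pi>)) $ i $ j = mat 1 $ i $ j" for i j :: 'n
    using bij_is_inj[OF assms]
    by (simp add: matrix_matrix_mult_def dagger_def perm_matrix_def if_distrib[of cnj] sum_delta_mult inj_eq)
      (simp add: mat_def)
  then have right: "perm_matrix \<pi> ** dagger (perm_matrix \<pi>) = (mat 1 :: complex ^ 'n ^ 'n)"
    by (simp add: vec_eq_iff)
  then have "dagger (perm_matrix \<pi>) ** perm_matrix \<pi> = (mat 1 :: complex ^ 'n ^ 'n)"
    by (simp add: matrix_left_right_inverse)
  with right show ?thesis by (simp add: unitary_def)
qed

lemma conjugate_perm_matrix: "conjugate (perm_matrix \<pi>) X $ i $ j = X $ \<pi> i $ \<pi> j"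
proof -
  have "conjugate (perm_matrix \<pi>) X $ i $ j = (\<Sum>k\<in>UNIV. (if k = \<pi> i then 1 else 0) *
    (\<Sum>l\<in>UNIV. X $ k $ l * (if l = \<pi> j then 1 else 0)))"
    unfolding conjugate_entry sum_distrib_left
    by (intro sum.cong refl) (simp add: perm_matrix_def)
  then show ?thesis by (simp add: sum_delta_mult)
qed

text \<open>The Householder reflection along \<open>e\<^sub>p + 2 e\<^sub>q\<close>, whose row \<open>p\<close> is \<open>(3/5, -4/5)\<close> in the
  coordinates \<open>p, q\<close>.\<close>

definition reflection_matrix :: "'n \<Rightarrow> 'n \<Rightarrow> complex ^ 'n ^ 'n"
  where "reflection_matrix p q = (let v = (\<lambda>i. if i = p then 1 else if i = q then 2 else 0) in
    \<chi> i j. (if j = i then 1 else 0) - 2 / 5 * v i * v j)"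

text \<open>The matrix is real symmetric, and \<open>2 / 5\<close> is 2 over the squared length of
  \<open>v\<close>, so it squares to the identity.\<close>

lemma unitary_reflection_matrix:
  fixes p q :: "'n::finite"
  assumes "p \<noteq> q" shows "unitary (reflection_matrix p q)"
proof -
  define v :: "'n \<Rightarrow> complex" where "v = (\<lambda>i. if i = p then 1 else if i = q then 2 else 0)"
  let ?W = "reflection_matrix p q"
  have W: "?W = (\<chi> i j. (if j = i then 1 else 0) - 2 / 5 * v i * v j)"
    by (simp add: reflection_matrix_def v_def Let_def)
  have vv: "(\<Sum>k\<in>UNIV. v k * v k) = 5"
  proof -
    have "(\<Sum>k\<in>UNIV. v k * v k) = (\<Sum>k\<in>{p,q}. v k * v k)"
      by (rule sum.mono_neutral_right) (auto simp: v_def)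
    then show ?thesis using assms by (simp add: v_def)
  qed
  have dag: "dagger ?W = ?W"
    by (simp add: W dagger_def vec_eq_iff v_def)
  have "(?W ** ?W) $ i $ j = mat 1 $ i $ j" for i j
  proof -
    have "(?W ** ?W) $ i $ j = (\<Sum>k\<in>UNIV. (if k = i then 1 else 0) * (if j = k then 1 else 0))
      - 2 / 5 * v j * (\<Sum>k\<in>UNIV. (if k = i then 1 else 0) * v k)
      - 2 / 5 * v i * (\<Sum>k\<in>UNIV. v k * (if k = j then 1 else 0))
      + 4 / 25 * v i * v j * (\<Sum>k\<in>UNIV. v k * v k)"
      unfolding sum_distrib_left sum_subtractf[symmetric] sum.distrib[symmetric]
      by (simp add: W matrix_matrix_mult_def) (intro sum.cong refl, simp add: algebra_simps)
    then show ?thesis unfolding vv sum_delta_mult by (simp add: mat_def)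
  qed
  then show ?thesis by (simp add: unitary_def dag vec_eq_iff)
qed

lemma conjugate_reflection_matrix:
  assumes "p \<noteq> q"
  shows "conjugate (reflection_matrix p q) X $ p $ p
    = 9 / 25 * X $ p $ p - 12 / 25 * X $ p $ q - 12 / 25 * X $ q $ p + 16 / 25 * X $ q $ q"
proof -
  let ?W = "reflection_matrix p q :: complex ^ 'a ^ 'a"
  have W: "?W $ p $ k = (if k = p then 3 / 5 else 0) + (if k = q then - 4 / 5 else 0)" for k
    using assms by (simp add: reflection_matrix_def Let_def)
  have "conjugate ?W X $ p $ p = (\<Sum>k\<in>UNIV. ?W $ p $ k * (\<Sum>l\<in>UNIV. X $ k $ l * cnj (?W $ p $ l)))"
    by (simp add: conjugate_entry sum_distrib_left mult.assoc)
  also have "\<dots> = 3 / 5 * (X $ p $ p * (3 / 5) + X $ p $ q * (- 4 / 5))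
      - 4 / 5 * (X $ q $ p * (3 / 5) + X $ q $ q * (- 4 / 5))"
    unfolding W complex_cnj_add if_distrib[of cnj] complex_cnj_zero distrib_left distrib_right
      sum.distrib sum_delta_mult by simp
  finally show ?thesis by (simp add: algebra_simps)
qed

section \<open>Invariance of Haar averages\<close>

locale unitary_haar =
  fixes \<mu> :: "(complex ^ 'n ^ 'n) measure"
  assumes haar: "unitary_haar_measure \<mu>"
begin

sublocale prob_space \<mu>
  using haar by (simp add: unitary_haar_measure_def)

lemma sets_haar: "sets \<mu> = sets (restrict_space borel {U. unitary U})"
  using haar by (simp add: unitary_haar_measure_def)

lemma space_haar: "space \<mu> = {U. unitary U}"
  using sets_eq_imp_space_eq[OF sets_haar] by (simp add: space_restrict_space)

lemma borel_measurable_haar: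
  fixes f :: "complex ^ 'n ^ 'n \<Rightarrow> 'b::topological_space"
  assumes "continuous_on UNIV f" shows "f \<in> borel_measurable \<mu>"
  unfolding measurable_cong_sets[OF sets_haar refl]
  by (intro measurable_restrict_space1 borel_measurable_continuous_onI assms)

text \<open>All unitaries have norm \<open>sqrt d\<close>, so they lie in a compact ball on which
  \<open>f\<close> is bounded, and bounded measurable functions are integrable for a probability
  measure.\<close>

lemma integrable_haar:
  fixes f :: "complex ^ 'n ^ 'n \<Rightarrow> complex"
  assumes "continuous_on UNIV f" shows "integrable \<mu> f"
proof -
  have "compact (f ` cball 0 (sqrt (real CARD('n))))"
    by (intro compact_continuous_image continuous_on_subset[OF assms] compact_cball) simp
  then have "bounded (f ` cball 0 (sqrt (real CARD('n))))" by (rule compact_imp_bounded)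
  then obtain B where B: "\<forall>y \<in> f ` cball 0 (sqrt (real CARD('n))). norm y \<le> B"
    unfolding bounded_iff ..
  have "norm (f U) \<le> B" if "U \<in> space \<mu>" for U
    using B norm_unitary[of U] that by (simp add: space_haar)
  then show ?thesis
    by (intro integrable_const_bound[of _ B] borel_measurable_haar assms) auto
qed

lemma integral_haar_shift:
  fixes f :: "complex ^ 'n ^ 'n \<Rightarrow> complex"
  assumes "continuous_on UNIV f" "unitary W"
  shows "(LINT U|\<mu>. f (W ** U)) = (LINT U|\<mu>. f U)"
proof -
  have "(\<lambda>U. W ** U) \<in> measurable \<mu> (restrict_space borel {U. unitary U})"
    using assms(2) unitary_mult
    by (intro measurable_restrict_space2 borel_measurable_haar continuous_intros) (auto simp: space_haar)
  then have "(\<lambda>U. W ** U) \<in> measurable \<mu> \<mu>"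
    using measurable_cong_sets[OF refl sets_haar] by blast
  then have "(LINT U|\<mu>. f (W ** U)) = (LINT U|distr \<mu> \<mu> (\<lambda>U. W ** U). f U)"
    by (simp add: integral_distr borel_measurable_haar assms(1))
  then show ?thesis using haar assms(2) by (simp add: unitary_haar_measure_def)
qed

definition second_moment :: "complex ^ 'n ^ 'n \<Rightarrow> 'n \<Rightarrow> 'n \<Rightarrow> 'n \<Rightarrow> 'n \<Rightarrow> complex"
  where "second_moment \<rho> i j k l =
    (LINT U|\<mu>. conjugate U \<rho> $ i $ j * conjugate U \<rho> $ k $ l)"

lemma integrable_entries: "integrable \<mu> (\<lambda>U. conjugate U \<rho> $ i $ j * conjugate U \<rho> $ k $ l)"
  by (intro integrable_haar continuous_intros)

lemma second_moment_shift:
  assumes "unitary W"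
  shows "second_moment \<rho> i j k l = (LINT U|\<mu>. conjugate W (conjugate U \<rho>) $ i $ j
    * conjugate W (conjugate U \<rho>) $ k $ l)"
proof -
  have "continuous_on UNIV (\<lambda>U. conjugate U \<rho> $ i $ j * conjugate U \<rho> $ k $ l)"
    by (intro continuous_intros)
  from integral_haar_shift[OF this assms] show ?thesis
    unfolding second_moment_def conjugate_mult by simp
qed

text \<open>Each occurrence of \<open>m\<close> as a row index contributes \<i>, each as a column
  index -\<i>. A sign flip in place of \<i> would not detect the moment of a squared off-diagonal
  entry.\<close>

lemma second_moment_phase:
  "second_moment \<rho> i j k l = (if i = m then \<i> else 1) * (if j = m then -\<i> else 1)
    * (if k = m then \<i> else 1) * (if l = m then -\<i> else 1) * second_moment \<rho> i j k l"
proof -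
  define w where "w = (if i = m then \<i> else 1) * (if j = m then -\<i> else 1)
    * (if k = m then \<i> else 1) * (if l = m then -\<i> else 1)"
  have "second_moment \<rho> i j k l
    = (LINT U|\<mu>. w * (conjugate U \<rho> $ i $ j * conjugate U \<rho> $ k $ l))"
    unfolding second_moment_shift[OF unitary_phase_matrix[of m]] conjugate_phase_matrix w_def
    by (simp only: mult_ac)
  also have "\<dots> = w * second_moment \<rho> i j k l" by (simp add: second_moment_def)
  finally show ?thesis by (simp only: w_def)
qed

lemma second_moment_eq_0:
  assumes "\<not> (i = j \<and> k = l)" "\<not> (i = l \<and> j = k)"
  shows "second_moment \<rho> i j k l = 0"
proof -
  \<comment> \<open>In each case the index chosen for \<open>m\<close> occurs more often as a row
    than as a column index, so the phase factor is \<i> or -1 and the moment must vanish.\<close>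
  consider "i \<noteq> j" "i \<noteq> l" | "i = j" "k \<noteq> l" | "i = l" "j \<noteq> k" using assms by blast
  then show ?thesis
  proof cases
    case 1
    then show ?thesis using second_moment_phase[of \<rho> i j k l i] by (auto split: if_splits)
  next
    case 2
    then show ?thesis using second_moment_phase[of \<rho> i j k l k] by (auto split: if_splits)
  next
    case 3
    then show ?thesis using second_moment_phase[of \<rho> i j k l k] by (auto split: if_splits)
  qed
qed

lemma second_moment_perm:
  assumes "bij \<pi>"
  shows "second_moment \<rho> i j k l = second_moment \<rho> (\<pi> i) (\<pi> j) (\<pi> k) (\<pi> l)"
  using second_moment_shift[OF unitary_perm_matrix[OF assms], of \<rho> i j k l]
  by (simp only: conjugate_perm_matrix second_moment_def[of \<rho> "\<pi> i"])

end

text \<open>The first transposition sends \<open>p\<close> to \<open>i\<close>; the second sends the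
  image of \<open>q\<close> to \<open>k\<close> and leaves \<open>i\<close> alone.\<close>

lemma exists_bij_pair:
  assumes "p \<noteq> q" "i \<noteq> k"
  obtains \<pi> :: "'n \<Rightarrow> 'n" where "bij \<pi>" "\<pi> p = i" "\<pi> q = k"
proof
  let ?r = "Transposition.transpose p i q"
  have r: "?r \<noteq> i"
    using assms by (auto simp: Transposition.transpose_def)
  show "bij (Transposition.transpose ?r k \<circ> Transposition.transpose p i)"
    by (intro bij_comp) simp_all
  show "(Transposition.transpose ?r k \<circ> Transposition.transpose p i) p = i"
    using r assms by (simp add: Transposition.transpose_def[of _ k])
  show "(Transposition.transpose ?r k \<circ> Transposition.transpose p i) q = k" by simp
qed

section \<open>The second-moment formula\<close>

context unitary_haar
begin

text \<open>Phases and permutations cannot relate moments with different index patterns; the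
  reflection mixes two coordinates and does. Squaring its formula for the entry at
  \<open>p, p\<close> and dropping the moments killed by phases leaves a linear equation, solved
  using \<open>1 - 337 / 625 = 288 / 625\<close>.\<close>

lemma second_moment_diag:
  assumes "p \<noteq> q"
  shows "second_moment \<rho> p p p p = second_moment \<rho> p p q q + second_moment \<rho> p q q p"
proof -
  let ?X = "\<lambda>U i j. conjugate U \<rho> $ i $ j"
  have qq: "second_moment \<rho> q q q q = second_moment \<rho> p p p p"
    using second_moment_perm[of "Transposition.transpose p q" \<rho> p p p p] by simp
  have "second_moment \<rho> p p p p = (LINT U|\<mu>. 81 / 625 * (?X U p p * ?X U p p)
      + 256 / 625 * (?X U q q * ?X U q q)
      + 144 / 625 * (?X U p q * ?X U p q) + 144 / 625 * (?X U q p * ?X U q p)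
      + 288 / 625 * (?X U p p * ?X U q q) + 288 / 625 * (?X U p q * ?X U q p)
      - 216 / 625 * (?X U p p * ?X U p q) - 216 / 625 * (?X U p p * ?X U q p)
      - 384 / 625 * (?X U p q * ?X U q q) - 384 / 625 * (?X U q p * ?X U q q))"
    unfolding second_moment_shift[OF unitary_reflection_matrix[OF assms]]
      conjugate_reflection_matrix[OF assms]
    by (intro Bochner_Integration.integral_cong refl) (simp add: algebra_simps)
  also have "\<dots> = 81 / 625 * second_moment \<rho> p p p p + 256 / 625 * second_moment \<rho> q q q q
      + 144 / 625 * second_moment \<rho> p q p q + 144 / 625 * second_moment \<rho> q p q p
      + 288 / 625 * second_moment \<rho> p p q q + 288 / 625 * second_moment \<rho> p q q p
      - 216 / 625 * second_moment \<rho> p p p q - 216 / 625 * second_moment \<rho> p p q p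
      - 384 / 625 * second_moment \<rho> p q q q - 384 / 625 * second_moment \<rho> q p q q"
    by (simp add: integrable_entries second_moment_def)
  also have "\<dots> = 337 / 625 * second_moment \<rho> p p p p
      + 288 / 625 * (second_moment \<rho> p p q q + second_moment \<rho> p q q p)"
    using assms by (simp add: second_moment_eq_0 qq)
  finally have eq: "second_moment \<rho> p p p p = 337 / 625 * second_moment \<rho> p p p p
      + 288 / 625 * (second_moment \<rho> p p q q + second_moment \<rho> p q q p)" .
  have "x = w" if "x = 337 / 625 * x + 288 / 625 * w" for x w :: complex
  proof -
    have "288 / 625 * x = x - 337 / 625 * x" by simp
    also have "\<dots> = 288 / 625 * w" by (subst (1) that) simp
    finally show ?thesis by simp
  qed
  from this[OF eq] show ?thesis .
qed

lemma second_moment_form: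
  assumes "CARD('n) \<ge> 2"
  obtains a b where "\<And>i j k l. second_moment \<rho> i j k l =
    (if i = j \<and> k = l then a else 0) + (if i = l \<and> j = k then b else 0)"
proof -
  have "\<not> CARD('n) \<le> Suc 0" using assms by simp
  then obtain p q :: 'n where pq: "p \<noteq> q" by (auto simp: card_le_Suc0_iff_eq)
  let ?a = "second_moment \<rho> p p q q" and ?b = "second_moment \<rho> p q q p"
  have a: "second_moment \<rho> i i k k = ?a" and b: "second_moment \<rho> i k k i = ?b" if "i \<noteq> k" for i k
  proof -
    obtain \<pi> :: "'n \<Rightarrow> 'n" where \<pi>: "bij \<pi>" "\<pi> p = i" "\<pi> q = k"
      by (rule exists_bij_pair[OF pq \<open>i \<noteq> k\<close>])
    show "second_moment \<rho> i i k k = ?a" "second_moment \<rho> i k k i = ?b"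
      unfolding second_moment_perm[OF \<pi>(1), of \<rho> p p q q] second_moment_perm[OF \<pi>(1), of \<rho> p q q p]
        \<pi>(2,3) by (rule refl)+
  qed
  \<comment> \<open>When all four indices agree both deltas fire, so the formula needs exactly the
    sum \<open>?a + ?b\<close>.\<close>
  have c: "second_moment \<rho> i i i i = ?a + ?b" for i
    using second_moment_perm[OF bij_transpose, of \<rho> p p p p p i]
    by (simp only: second_moment_diag[OF pq] transpose_apply_first)
  have "second_moment \<rho> i j k l = (if i = j \<and> k = l then ?a else 0) + (if i = l \<and> j = k then ?b else 0)"
    for i j k l
  proof -
    consider "i = j" "k = l" "i = l" | "i = j" "k = l" "i \<noteq> l" | "i = l" "j = k" "i \<noteq> j"
      | "\<not> (i = j \<and> k = l)" "\<not> (i = l \<and> j = k)" by blast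
    then show ?thesis
    proof cases
      case 1 then show ?thesis using c by simp
    next
      case 2 then show ?thesis using a[of i k] by simp
    next
      case 3 then show ?thesis using b[of i j] by simp
    next
      case 4 then show ?thesis using second_moment_eq_0[OF 4] by (simp only: if_False add_0_left)
    qed
  qed
  then show ?thesis by (rule that)
qed

text \<open>Expanding the square, the parallel pairing of indices contracts to the squared trace of
  \<open>B\<close> and the crossed pairing to the trace of its square.\<close>

lemma integral_trace_mult_sq:
  assumes form: "\<And>i j k l. second_moment \<rho> i j k l =
    (if i = j \<and> k = l then a else 0) + (if i = l \<and> j = k then b else 0)"
  shows "(LINT U|\<mu>. (trace (B ** conjugate U \<rho>))\<^sup>2) = a * (trace B)\<^sup>2 + b * trace (B ** B)"
proof -
  let ?X = "\<lambda>U i j. conjugate U \<rho> $ i $ j"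
  have "(trace (B ** conjugate U \<rho>))\<^sup>2 = (\<Sum>i\<in>UNIV. \<Sum>j\<in>UNIV. \<Sum>k\<in>UNIV. \<Sum>l\<in>UNIV.
      B $ i $ j * B $ k $ l * (?X U j i * ?X U l k))" for U
    unfolding trace_mult_eq_sum power2_eq_square sum_distrib_left sum_distrib_right
    by (simp only: mult_ac)
  then have "(LINT U|\<mu>. (trace (B ** conjugate U \<rho>))\<^sup>2) = (\<Sum>i\<in>UNIV. \<Sum>j\<in>UNIV. \<Sum>k\<in>UNIV. \<Sum>l\<in>UNIV.
      B $ i $ j * B $ k $ l * second_moment \<rho> j i l k)"
    by (simp add: integrable_entries second_moment_def)
  \<comment> \<open>The first summand is split as a product over \<open>(i, j)\<close> and
    \<open>(k, l)\<close>, the second as nested deltas, so that the sums collapse one index at a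
    time.\<close>
  also have "\<dots> = (\<Sum>i\<in>UNIV. \<Sum>j\<in>UNIV. \<Sum>k\<in>UNIV. \<Sum>l\<in>UNIV.
      (if j = i then B $ i $ j * a else 0) * (if l = k then B $ k $ l else 0)
      + (if l = i then if k = j then B $ i $ j * B $ k $ l * b else 0 else 0))"
    unfolding form by (intro sum.cong refl) (auto simp: algebra_simps)
  also have "\<dots> = a * (trace B)\<^sup>2 + b * trace (B ** B)"
    unfolding sum.distrib sum_distrib_left[symmetric] sum_distrib_right[symmetric]
    by (simp add: trace_def[of B] trace_mult_eq_sum sum_distrib_left sum_distrib_right power2_eq_square mult_ac)
  finally show ?thesis .
qed

lemma
  assumes form: "\<And>i j k l. second_moment \<rho> i j k l =
    (if i = j \<and> k = l then a else 0) + (if i = l \<and> j = k then b else 0)"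
  shows second_moment_trace_sq: "(of_nat CARD('n))\<^sup>2 * a + of_nat CARD('n) * b = (trace \<rho>)\<^sup>2"
    and second_moment_sq_trace: "of_nat CARD('n) * a + (of_nat CARD('n))\<^sup>2 * b = trace (\<rho> ** \<rho>)"
    and second_moment_first: "(LINT U|\<mu>. conjugate U \<rho> $ i $ j) * trace \<rho>
      = (if i = j then of_nat CARD('n) * a + b else 0)"
proof -
  \<comment> \<open>Both full contractions are constant on the unitary orbit, namely the squared
    trace and the trace of the square. Contracting only the second factor recovers the first moment
    without another invariance argument.\<close>
  let ?X = "\<lambda>U i j. conjugate U \<rho> $ i $ j"
  have "(\<Sum>i\<in>UNIV. \<Sum>k\<in>UNIV. second_moment \<rho> i i k k) = (LINT U|\<mu>. (\<Sum>i\<in>UNIV. \<Sum>k\<in>UNIV. ?X U i i * ?X U k k))"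
    by (simp add: integrable_entries second_moment_def)
  also have "\<dots> = (LINT U|\<mu>. (trace (conjugate U \<rho>))\<^sup>2)"
    by (simp only: trace_def power2_eq_square sum_product)
  also have "\<dots> = (LINT U|\<mu>. (trace \<rho>)\<^sup>2)"
    by (intro Bochner_Integration.integral_cong refl) (simp add: space_haar trace_conjugate)
  also have "\<dots> = (trace \<rho>)\<^sup>2" by (simp add: prob_space)
  finally show "(of_nat CARD('n))\<^sup>2 * a + of_nat CARD('n) * b = (trace \<rho>)\<^sup>2"
    unfolding form by (simp add: sum.distrib power2_eq_square algebra_simps)
  have "(\<Sum>i\<in>UNIV. \<Sum>k\<in>UNIV. second_moment \<rho> i k k i) = (LINT U|\<mu>. (\<Sum>i\<in>UNIV. \<Sum>k\<in>UNIV. ?X U i k * ?X U k i))"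
    by (simp add: integrable_entries second_moment_def)
  also have "\<dots> = (LINT U|\<mu>. trace (conjugate U \<rho> ** conjugate U \<rho>))"
    by (simp only: trace_mult_eq_sum)
  also have "\<dots> = (LINT U|\<mu>. trace (\<rho> ** \<rho>))"
    by (intro Bochner_Integration.integral_cong refl) (simp add: space_haar conjugate_sq trace_conjugate)
  also have "\<dots> = trace (\<rho> ** \<rho>)" by (simp add: prob_space)
  finally have "(\<Sum>i\<in>UNIV. \<Sum>k\<in>UNIV. second_moment \<rho> i k k i) = trace (\<rho> ** \<rho>)" .
  moreover have "i = k \<and> k = i \<longleftrightarrow> k = i" for i k :: 'n by auto
  ultimately show "of_nat CARD('n) * a + (of_nat CARD('n))\<^sup>2 * b = trace (\<rho> ** \<rho>)"
    unfolding form by (simp add: sum.distrib power2_eq_square algebra_simps)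
  have "(\<Sum>k\<in>UNIV. second_moment \<rho> i j k k) = (LINT U|\<mu>. (\<Sum>k\<in>UNIV. ?X U i j * ?X U k k))"
    by (simp add: integrable_entries second_moment_def)
  also have "\<dots> = (LINT U|\<mu>. ?X U i j * trace (conjugate U \<rho>))"
    by (simp only: trace_def sum_distrib_left)
  also have "\<dots> = (LINT U|\<mu>. ?X U i j * trace \<rho>)"
    by (intro Bochner_Integration.integral_cong refl) (simp add: space_haar trace_conjugate)
  also have "\<dots> = (LINT U|\<mu>. ?X U i j) * trace \<rho>" by simp
  finally have "(LINT U|\<mu>. ?X U i j) * trace \<rho> = (\<Sum>k\<in>UNIV. second_moment \<rho> i j k k)" by (rule sym)
  moreover have "(\<Sum>k\<in>UNIV. if i = k \<and> j = k then b else 0) = (if i = j then b else 0)"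
    by (cases "i = j") (auto intro!: sum.neutral)
  ultimately show "(LINT U|\<mu>. ?X U i j) * trace \<rho> = (if i = j then of_nat CARD('n) * a + b else 0)"
    unfolding form by (simp only: sum.distrib) simp
qed

end

section \<open>Averaging the variance and assembling the bound\<close>

theorem mainTheorem5:
  fixes I :: "'a set"
    and A :: "'a \<Rightarrow> complex ^ 'n ^ 'n"
    and Obs \<rho> :: "complex ^ 'n ^ 'n"
    and \<mu> :: "(complex ^ 'n ^ 'n) measure"
    and d V P :: real
  assumes "CARD('n) \<ge> 2"
    and "povm I A"
    and "informationally_complete I A"
    and "hermitian Obs"
    and "density_operator \<rho>"
    and "purity \<rho> = P"
    and "unitary_haar_measure \<mu>"
    and "d = real CARD('n)"
    and "V = Re (trace (Obs ** Obs)) - (Re (trace Obs))\<^sup>2 / d"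
  shows "average_variance \<mu> I A Obs \<rho>
    \<le> V / d * (1 / completeness_stability I A - (d * P - 1) / (d\<^sup>2 - 1))"
proof -
  note povm = assms(2) and ic = assms(3) and herm = assms(4) and d = assms(8) and V = assms(9)
  interpret unitary_haar \<mu> by unfold_locales (rule assms(7))
  have d2: "d \<ge> 2" using assms(1) d by simp
  have dc: "of_nat CARD('n) = complex_of_real d" by (simp add: d)
  have herm_\<rho>: "hermitian \<rho>" and tr_\<rho>: "trace \<rho> = 1"
    using assms(5) by (auto simp: density_operator_def pos_semidef_def)
  have tr_sq: "trace (\<rho> ** \<rho>) = complex_of_real P"
    using trace_mult_hermitian_real[OF herm_\<rho> herm_\<rho>] assms(6) by (simp add: purity_def)
  obtain a b where form: "\<And>i j k l. second_moment \<rho> i j k l =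
    (if i = j \<and> k = l then a else 0) + (if i = l \<and> j = k then b else 0)"
    by (rule second_moment_form[OF assms(1), of \<rho>]) (rule that; assumption)
  have eq1: "complex_of_real (d\<^sup>2) * a + complex_of_real d * b = 1"
    using second_moment_trace_sq[OF form] by (simp add: dc tr_\<rho>)
  have eq2: "complex_of_real d * a + complex_of_real (d\<^sup>2) * b = complex_of_real P"
    using second_moment_sq_trace[OF form] by (simp add: dc tr_sq)
  \<comment> \<open>The coefficients are real, so taking real parts gives a real linear system; only
    \<open>Re a\<close> and \<open>Re b\<close> enter the final bound.\<close>
  have Re1: "d\<^sup>2 * Re a + d * Re b = 1" and Re2: "d * Re a + d\<^sup>2 * Re b = P"
    using arg_cong[OF eq1, of Re] arg_cong[OF eq2, of Re] by simp_all
  have mean: "(LINT U|\<mu>. conjugate U \<rho> $ i $ j) = (if j = i then 1 / complex_of_real d else 0)" for i j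
  proof -
    have "complex_of_real d * (complex_of_real d * a + b) = 1"
      using eq1 by (simp add: power2_eq_square algebra_simps)
    then have "complex_of_real d * a + b = 1 / complex_of_real d"
      using d2 by (simp add: field_simps)
    then show ?thesis using second_moment_first[OF form, of i j] by (auto simp: tr_\<rho> dc)
  qed
  let ?e = "estimator I A Obs" and ?t = "\<lambda>a. Re (trace (A a))"
  let ?T = "Re (trace Obs)" and ?S = "Re (trace (Obs ** Obs))"
  have mean_trace: "(LINT U|\<mu>. trace (conjugate U \<rho> ** B)) = trace B / complex_of_real d" for B
  proof -
    have "integrable \<mu> (\<lambda>U. conjugate U \<rho> $ i $ j)" for i j
      by (intro integrable_haar continuous_intros)
    then have "(LINT U|\<mu>. trace (conjugate U \<rho> ** B))
      = (\<Sum>i\<in>UNIV. \<Sum>j\<in>UNIV. (if j = i then 1 / complex_of_real d else 0) * B $ j $ i)"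
      unfolding trace_mult_eq_sum by (simp add: mean)
    then show ?thesis unfolding sum_delta_mult by (simp add: trace_def sum_divide_distrib)
  qed
  have int_trace: "integrable \<mu> (\<lambda>U. trace (conjugate U \<rho> ** B))"
    "integrable \<mu> (\<lambda>U. (trace (B ** conjugate U \<rho>))\<^sup>2)" for B
    unfolding trace_def by (intro integrable_haar continuous_intros)+
  \<comment> \<open>A complex integrand, so that the moment formulas apply directly. Hermiticity
    makes the square of the trace equal to the square of its real part.\<close>
  let ?f = "\<lambda>U. (\<Sum>a\<in>I. complex_of_real ((?e a)\<^sup>2) * trace (conjugate U \<rho> ** A a))
    - (trace (Obs ** conjugate U \<rho>))\<^sup>2"
  have "estimator_variance I A Obs (conjugate U \<rho>) = Re (?f U)" for U
  proof -
    have "(trace (Obs ** conjugate U \<rho>))\<^sup>2 = complex_of_real ((Re (trace (Obs ** conjugate U \<rho>)))\<^sup>2)"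
      using arg_cong[OF trace_mult_hermitian_real[OF herm hermitian_conjugate[OF herm_\<rho>]], of power2]
      by (simp only: of_real_power)
    then show ?thesis
      by (simp add: estimator_variance_def outcome_prob_def mult.commute del: of_real_power)
  qed
  then have "average_variance \<mu> I A Obs \<rho> = (LINT U|\<mu>. Re (?f U))"
    by (simp add: average_variance_def)
  also have "\<dots> = Re (LINT U|\<mu>. ?f U)"
    by (rule integral_Re) (intro Bochner_Integration.integrable_diff Bochner_Integration.integrable_sum
        Bochner_Integration.integrable_mult_right int_trace)
  also have "(LINT U|\<mu>. ?f U) = (\<Sum>a\<in>I. complex_of_real ((?e a)\<^sup>2) * (trace (A a) / complex_of_real d))
      - (a * (trace Obs)\<^sup>2 + b * trace (Obs ** Obs))"
    by (subst Bochner_Integration.integral_diff)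
      (simp_all add: int_trace mean_trace integral_trace_mult_sq[OF form] del: of_real_power)
  also have "Re \<dots> = (\<Sum>a\<in>I. ?t a * (?e a)\<^sup>2) / d - (Re a * ?T\<^sup>2 + Re b * ?S)"
  proof -
    have "(trace Obs)\<^sup>2 = complex_of_real (?T\<^sup>2)"
      using arg_cong[OF trace_hermitian_real[OF herm], of power2] by (simp only: of_real_power)
    then have "Re (a * (trace Obs)\<^sup>2) = Re a * ?T\<^sup>2" by simp
    moreover have "Re (b * trace (Obs ** Obs)) = Re b * ?S"
      by (subst trace_mult_hermitian_real[OF herm herm]) simp
    ultimately have "Re (a * (trace Obs)\<^sup>2 + b * trace (Obs ** Obs)) = Re a * ?T\<^sup>2 + Re b * ?S"
      by simp
    then show ?thesis
      by (simp add: sum_divide_distrib mult.commute del: of_real_power)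
  qed
  also have "\<dots> \<le> (V / completeness_stability I A + ?T\<^sup>2 / d) / d - (Re a * ?T\<^sup>2 + Re b * ?S)"
    using order_trans[OF sum_estimator_sq_le[OF povm ic herm] inner_inv_scaled_frame_op_le[OF povm ic herm d V]] d2
    by (simp add: divide_right_mono)
  also have "\<dots> = V / d * (1 / completeness_stability I A - (d * P - 1) / (d\<^sup>2 - 1))"
  proof -
    have "d\<^sup>2 - 1 > 0" using one_less_power[of d 2] d2 by simp
    \<comment> \<open>Eliminating \<open>Re a\<close> from the two contractions shows that the
      purity term of the claim is \<open>d * Re b\<close>.\<close>
    have "d * Re b * (d\<^sup>2 - 1) = d * P - 1"
      using Re1 unfolding Re2[symmetric] by (simp add: power2_eq_square algebra_simps)
    then have b: "(d * P - 1) / (d\<^sup>2 - 1) = d * Re b"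
      using \<open>d\<^sup>2 - 1 > 0\<close> by (simp add: field_simps)
    have a: "Re a = (1 - d * Re b) / d\<^sup>2" using Re1 d2 by (simp add: field_simps)
    \<comment> \<open>Here \<open>u\<close> is the squared trace over \<open>d\<close>, so
      \<open>S - u\<close> is \<open>V\<close>. The contribution \<open>u / d\<close> of the
      identity component cancels against the part of \<open>Re a\<close> that does not involve
      \<open>Re b\<close>.\<close>
    have key: "((S - u) * k + u) / d - ((1 - d * r) / d\<^sup>2 * (d * u) + r * S) = (S - u) / d * (k - d * r)"
      for S u k r :: real
    proof -
      have "((S - u) * k + u) / d = (S - u) * k / d + u / d" by (rule add_divide_distrib)
      moreover have "(1 - d * r) / d\<^sup>2 * (d * u) = u / d - r * u"
        using d2 by (simp add: power2_eq_square diff_divide_distrib left_diff_distrib)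
      moreover have "(S - u) / d * (k - d * r) = (S - u) * k / d - r * (S - u)"
        using d2 by (simp add: right_diff_distrib) (simp add: algebra_simps)
      ultimately show ?thesis using right_diff_distrib[of r S u] by linarith
    qed
    have "d * (?T\<^sup>2 / d) = ?T\<^sup>2" using d2 by simp
    with key[of ?S "?T\<^sup>2 / d" "1 / completeness_stability I A" "Re b"] show ?thesis
      unfolding b a V by simp
  qed
  finally show ?thesis .
qed

end
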